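(* Let $s\ge2$, $2\le w<r<\overline{n}$, $n=s\overline{n}$, and let $c$ be a primitive element of $\mathbf{F}_q$ with $q>\lceil\frac{\overline{n}}{w}\rceil sw$. Set $x_{u\overline{n}+i}=c^{u\lceil\overline{n}/w\rceil}$ for $u\in[0:s)$ and $i\in[0:\overline{n})$. Then for every $u\in[0:s)$ and $i\in[0:\overline{n})$ the following hold: i) for all $v_0,v_1\in[0:s)$ and $j_0,j_1\in[0:\overline{n}-1)$ with $(v_0,j_0)\ne(v_1,j_1)$: $$\begin{cases}x_{v_0\overline{n}+j_0}^wc^{j_0}\ne x_{v_1\overline{n}+j_1}^wc^{j_1},&\text{if }j_0,j_1\in[0:i),\\ x_{v_0\overline{n}+j_0+1}^wc^{j_0}\ne x_{v_1\overline{n}+j_1+1}^wc^{j_1},&\text{if }j_0,j_1\in[i:\overline{n}-1),\\ x_{v_0\overline{n}+j_0}^wc^{j_0}\ne x_{v_1\overline{n}+j_1+1}^wc^{j_1+1},&\text{if }j_0\in[0:i),\ j_1\in[i:\overline{n}-1);\end{cases}$$ ii) for all $v\in[0:s)$: $x_{v\overline{n}+j}^wc^j-x_{u\overline{n}+i}^wc^i\ne0$ if $j\in[0:i)$, and $x_{v\overline{n}+j+1}^wc^{j+1}-x_{u\overline{n}+i}^wc^i\ne0$ if $j\in[i:\overline{n}-1)$.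
   Context: $[a:b)=\{a,a+1,\dots,b-1\}$. Conditions i) and ii) are the sufficient conditions on the elements $x_0,\dots,x_{n-1}\in\mathbf{F}_q\setminus\{0\}$ for the paper's code $\mathcal{C}_3$ to be an MDS array code with its asserted repair property. *)

theory Defs
  imports Complex_Main "HOL-Library.Cardinality"
begin

text \<open>
  A primitive element of a finite field is a generator of its multiplicative group. Natural
  exponents suffice, since in a finite group inverses are nonnegative powers; \<open>c \<noteq> 0\<close> is
  implied because \<open>c = c ^ 1\<close> lies in the range.
\<close>

definition primitive_element :: "'a::{field,finite} \<Rightarrow> bool" where
  "primitive_element c \<longleftrightarrow> range (\<lambda>k::nat. c ^ k) = UNIV - {0}"

end

theory Submission
  imports Defs
begin

text \<open>
  With \<open>M = w * \<lceil>nbar / w\<rceil> \<ge> nbar\<close>, every element compared is \<open>c ^ (v * M + j)\<close> with \<open>v < s\<close> and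
  \<open>j < M\<close>. Division with remainder by \<open>M\<close> makes these exponents distinct for distinct pairs
  \<open>(v, j)\<close>, and they are smaller than \<open>s * M\<close>, hence than the order \<open>q - 1\<close> of \<open>c\<close>.
\<close>

text \<open>If \<open>c ^ d = 1\<close>, exponents may be reduced modulo \<open>d\<close>, so
  \<open>c\<close> has at most \<open>d\<close> distinct powers. Being primitive, it needs
  \<open>CARD('a) - 1\<close> of them.\<close>

lemma primitive_element_power_neq_one:
  fixes c :: "'a::{field,finite}"
  assumes "primitive_element c" and "0 < d" and "d < CARD('a) - 1"
  shows "c ^ d \<noteq> 1"
proof
  assume d: "c ^ d = 1"
  have "c ^ k \<in> (\<lambda>k. c ^ k) ` {..<d}" for k
  proof
    have "c ^ k = c ^ (d * (k div d) + k mod d)" by simp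
    also have "\<dots> = c ^ (k mod d)" unfolding power_add power_mult d by simp
    finally show "c ^ k = c ^ (k mod d)" .
    show "k mod d \<in> {..<d}" using \<open>0 < d\<close> by simp
  qed
  then have "range (\<lambda>k. c ^ k) \<subseteq> (\<lambda>k. c ^ k) ` {..<d}"
    by (rule image_subsetI)
  then have "UNIV - {0} \<subseteq> (\<lambda>k. c ^ k) ` {..<d}"
    using assms(1) by (simp only: primitive_element_def)
  then have "card (UNIV - {0::'a}) \<le> d"
    by (metis surj_card_le[OF finite_lessThan] card_lessThan)
  then show False using assms(3) by simp
qed

text \<open>A coincidence \<open>c ^ a = c ^ b\<close> with \<open>a < b\<close> would cancel to
  \<open>c ^ (b - a) = 1\<close>, where \<open>b - a\<close> is positive and below
  \<open>CARD('a) - 1\<close>.\<close>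

lemma primitive_element_inj_on_power:
  fixes c :: "'a::{field,finite}"
  assumes "primitive_element c"
  shows "inj_on (\<lambda>k. c ^ k) {..<CARD('a) - 1}"
proof (rule linorder_inj_onI)
  fix a b :: nat
  assume "a < b" and ab: "a \<in> {..<CARD('a) - 1}" "b \<in> {..<CARD('a) - 1}"
  have "c \<noteq> 0"
    using assms power_one_right[of c] unfolding primitive_element_def by blast
  moreover have "c ^ (b - a) \<noteq> 1"
    using primitive_element_power_neq_one[OF assms, of "b - a"] \<open>a < b\<close> ab by simp
  moreover have "c ^ b = c ^ a * c ^ (b - a)"
    using \<open>a < b\<close> by (simp flip: power_add)
  ultimately show "c ^ a \<noteq> c ^ b" by simp
qed auto

lemma primitive_element_mixed_radix_power_eq_iff:
  fixes c :: "'a::{field,finite}"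
  assumes "primitive_element c" and "s * M < CARD('a)"
    and "v0 < s" "v1 < s" "j0 < M" "j1 < M"
  shows "c ^ (v0 * M + j0) = c ^ (v1 * M + j1) \<longleftrightarrow> v0 = v1 \<and> j0 = j1"
proof
  \<comment> \<open>The strict bound \<open>s * M < CARD('a)\<close> is what leaves room for the
    \<open>- 1\<close>: the exponent is strictly below \<open>s * M\<close>, which is at most
    \<open>CARD('a) - 1\<close>.\<close>
  have less: "v * M + j < CARD('a) - 1" if "v < s" "j < M" for v j
  proof -
    have "v * M + j < Suc v * M" using that by simp
    also have "\<dots> \<le> s * M" using that by (intro mult_le_mono1) simp
    finally show ?thesis using assms(2) by simp
  qed
  assume "c ^ (v0 * M + j0) = c ^ (v1 * M + j1)"
  then have eq: "v0 * M + j0 = v1 * M + j1"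
    using inj_onD[OF primitive_element_inj_on_power[OF assms(1)]] less assms(3-6) by simp
  have "v0 = v1"
    using arg_cong[OF eq, of "\<lambda>k. k div M"] assms(5,6) by simp
  then show "v0 = v1 \<and> j0 = j1" using eq by simp
qed simp

theorem theorem9:
  fixes q s w r nbar n :: nat
    and c :: "'a::{field,finite}"
    and x :: "nat \<Rightarrow> 'a"
  assumes "CARD('a) = q"
    and "2 \<le> s"
    and "2 \<le> w" and "w < r" and "r < nbar"
    and "n = s * nbar"
    and "primitive_element c"
    and "q > nat \<lceil>real nbar / real w\<rceil> * s * w"
    and "\<forall>u\<in>{0..<s}. \<forall>i\<in>{0..<nbar}. x (u * nbar + i) = c ^ (u * nat \<lceil>real nbar / real w\<rceil>)"
  shows "\<forall>u\<in>{0..<s}. \<forall>i\<in>{0..<nbar}.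
    (\<forall>v0\<in>{0..<s}. \<forall>v1\<in>{0..<s}. \<forall>j0\<in>{0..<nbar - 1}. \<forall>j1\<in>{0..<nbar - 1}.
       (v0, j0) \<noteq> (v1, j1) \<longrightarrow>
         (j0 \<in> {0..<i} \<and> j1 \<in> {0..<i} \<longrightarrow>
            x (v0 * nbar + j0) ^ w * c ^ j0 \<noteq> x (v1 * nbar + j1) ^ w * c ^ j1) \<and>
         (j0 \<in> {i..<nbar - 1} \<and> j1 \<in> {i..<nbar - 1} \<longrightarrow>
            x (v0 * nbar + j0 + 1) ^ w * c ^ j0 \<noteq> x (v1 * nbar + j1 + 1) ^ w * c ^ j1) \<and>
         (j0 \<in> {0..<i} \<and> j1 \<in> {i..<nbar - 1} \<longrightarrow>
            x (v0 * nbar + j0) ^ w * c ^ j0 \<noteq> x (v1 * nbar + j1 + 1) ^ w * c ^ (j1 + 1))) \<and>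
    (\<forall>v\<in>{0..<s}. \<forall>j\<in>{0..<nbar - 1}.
       (j \<in> {0..<i} \<longrightarrow>
          x (v * nbar + j) ^ w * c ^ j - x (u * nbar + i) ^ w * c ^ i \<noteq> 0) \<and>
       (j \<in> {i..<nbar - 1} \<longrightarrow>
          x (v * nbar + j + 1) ^ w * c ^ (j + 1) - x (u * nbar + i) ^ w * c ^ i \<noteq> 0))"
proof -
  define t where "t = nat \<lceil>real nbar / real w\<rceil>"
  define M where "M = t * w"
  have "real nbar / real w \<le> real t"
    unfolding t_def by (rule of_nat_ceiling)
  then have "real nbar \<le> real M"
    using \<open>2 \<le> w\<close> by (simp add: M_def field_simps)
  then have M: "nbar \<le> M" by simp
  \<comment> \<open>The value of \<open>x\<close> depends only on the block \<open>v\<close>, and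
    the \<open>w\<close>-th power turns its exponent \<open>v * t\<close> into
    \<open>v * M\<close>.\<close>
  have xw: "x (v * nbar + j) ^ w = c ^ (v * M)" if "v < s" "j < nbar" for v j
    using assms(9) that by (simp add: t_def M_def power_mult mult.assoc)
  \<comment> \<open>Since \<open>j < nbar - 1\<close>, the shifted index stays inside block
    \<open>v\<close>.\<close>
  have xw_Suc: "x (v * nbar + j + 1) ^ w = c ^ (v * M)" if "v < s" "j < nbar - 1" for v j
    using xw[of v "j + 1"] that by (simp add: add.assoc)
  have "s * M < CARD('a)"
    using assms(1,8) by (simp add: t_def M_def mult_ac)
  note eq_iff = primitive_element_mixed_radix_power_eq_iff[OF \<open>primitive_element c\<close> this]
  have xj: "c ^ (v0 * M) * c ^ j0 = c ^ (v1 * M) * c ^ j1 \<longleftrightarrow> v0 = v1 \<and> j0 = j1"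
    if "v0 < s" "v1 < s" "j0 < nbar" "j1 < nbar" for v0 v1 j0 j1
    using eq_iff[of v0 v1 j0 j1] that M by (simp add: power_add)
  show ?thesis
  proof (intro ballI conjI impI, goal_cases)
    case (1 u i v0 v1 j0 j1)
    then show ?case using xw[of v0 j0] xw[of v1 j1] xj[of v0 v1 j0 j1] by simp
  next
    \<comment> \<open>Only the indices of \<open>x\<close> are shifted here; the powers of
      \<open>c\<close> keep \<open>j0\<close> and \<open>j1\<close>, so the pairs compared are still
      \<open>(v0, j0)\<close> and \<open>(v1, j1)\<close>.\<close>
    case (2 u i v0 v1 j0 j1)
    then show ?case
      using xw_Suc[of v0 j0] xw_Suc[of v1 j1] xj[of v0 v1 j0 j1] by simp
  next
    case (3 u i v0 v1 j0 j1)
    \<comment> \<open>The low digits differ whatever the blocks are, because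
      \<open>j0 < i \<le> j1 < j1 + 1\<close>.\<close>
    then have "c ^ (v0 * M) * c ^ j0 \<noteq> c ^ (v1 * M) * c ^ (j1 + 1)"
      by (subst xj) auto
    then show ?case
      using 3 xw[of v0 j0] xw_Suc[of v1 j1] by simp
  next
    case (4 u i v j)
    then show ?case using xw[of v j] xw[of u i] xj[of v u j i] by simp
  next
    case (5 u i v j)
    \<comment> \<open>Here \<open>i \<le> j < j + 1\<close> separates the low digits, even when
      \<open>v = u\<close>.\<close>
    then have "c ^ (v * M) * c ^ (j + 1) \<noteq> c ^ (u * M) * c ^ i"
      by (subst xj) auto
    then show ?case
      using 5 xw_Suc[of v j] xw[of u i] by simp
  qed
qed

end
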